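(* For every integer $N\ge0$, $$[t^{2N}]G'(t,q)=\dfrac{1}{(1-q)^{2N}}\sum\limits_{m=0}^{N}\dfrac{q^{m^2+m}\left(\sum\limits_{l=-m}^{m}(-1)^l q^{-l^2}\right)(2m+1)\binom{2N}{N+m}}{N+m+1}\,,$$ where $[t^{2N}]G'(t,q)$ denotes the coefficient of $t^{2N}$ in $G'(t,q)$.
   Context: A Dyck path of length $2N$ is a lattice path from $(0,0)$ to $(2N,0)$ with $N$ steps $(1,1)$ and $N$ steps $(1,-1)$ that never goes below $y=0$. Its steps are labelled: $a_j$ is a step $(1,1)$ starting at height $j\ge 0$, and $b_k$ is a step $(1,-1)$ starting at height $k\ge1$. Thus a Dyck path is encoded as a word $u_1u_2\cdots u_{2N}$ in these labels. Given a possibility function $pos:\{a_0,a_1,\ldots\}\cup\{b_1,b_2,\ldots\}\to\mathbb{N}_0$, a path diagram is a Dyck path $u_1\cdots u_{2N}$ together with a sequence of integers $s_1,\ldots,s_{2N}$ with $0\le s_i\le pos(u_i)$ for all $i$. Here the possibility function is $pos(a_j)=j$ for $j\ge0$, $pos(b_k)=k-1$ for $k\ge1$. The generating function of unrestricted path diagrams is the formal power series $$G'(t,q)=\sum_{N,m\ge0}b_{N,m}t^{2N}q^m,$$ where $b_{N,m}$ is the number of such path diagrams whose Dyck path has length $2N$ (no restriction on height) and with $s_1+\cdots+s_{2N}=m$ (the empty path counts once for $N=m=0$); the prime is part of the name, not a derivative. For each $N$ the coefficient of $t^{2N}$ is a polynomial in $q$. *)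

theory Defs
  imports "HOL-Computational_Algebra.Formal_Laurent_Series"
begin

datatype step = Up | Down

fun rise :: "step \<Rightarrow> int" where
  "rise Up = 1"
| "rise Down = -1"

definition height :: "step list \<Rightarrow> nat \<Rightarrow> int" where
  "height p i = (\<Sum>u\<leftarrow>take i p. rise u)"

text \<open>A lattice path starting at \<open>(0,0)\<close> is represented by the list of its steps, so that
  \<open>(i, height p i)\<close> is the point reached after \<open>i\<close> steps.\<close>

definition dyck_path :: "nat \<Rightarrow> step list \<Rightarrow> bool" where
  "dyck_path N p \<longleftrightarrow>
     length p = 2 * N \<and> count_list p Up = N \<and> count_list p Down = N \<and>
     (\<forall>i\<le>2 * N. height p i \<ge> 0)"

text \<open>\<open>A j\<close> and \<open>B k\<close> are the labels \<open>a\<^sub>j\<close> and \<open>b\<^sub>k\<close>. The junk label \<open>B 0\<close> does not occur in the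
  word of a Dyck path, as a down step cannot start at height \<open>0\<close>.\<close>

datatype label = A nat | B nat

definition step_label :: "step list \<Rightarrow> nat \<Rightarrow> label" where
  "step_label p i = (case p ! i of
      Up \<Rightarrow> A (nat (height p i))
    | Down \<Rightarrow> B (nat (height p i)))"

definition dyck_word :: "step list \<Rightarrow> label list" where
  "dyck_word p = map (step_label p) [0..<length p]"

definition path_diagrams :: "(label \<Rightarrow> nat) \<Rightarrow> nat \<Rightarrow> (step list \<times> int list) set" where
  "path_diagrams pos N =
     {(p, s). dyck_path N p \<and> length s = 2 * N \<and>
        (\<forall>i<2 * N. 0 \<le> s ! i \<and> s ! i \<le> int (pos (dyck_word p ! i)))}"

lemma finite_path_diagrams: "finite (path_diagrams pos N)"
proof -
  have fin_paths: "finite {p :: step list. length p = 2 * N}"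
  proof -
    have "UNIV = {Up, Down}"
      using step.exhaust by auto
    then have "finite (UNIV :: step set)"
      by (metis finite.emptyI finite.insertI)
    from finite_lists_length_eq[OF this, of "2 * N"] show ?thesis
      by simp
  qed
  define S where "S p = {s :: int list. length s = 2 * N \<and>
        (\<forall>i<2 * N. 0 \<le> s ! i \<and> s ! i \<le> int (pos (dyck_word p ! i)))}" for p
  have "finite (S p)" for p
  proof -
    define M where "M = (\<Sum>i<2 * N. int (pos (dyck_word p ! i)))"
    have "s ! i \<in> {0..M}" if "s \<in> S p" "i < 2 * N" for s i
    proof -
      have "int (pos (dyck_word p ! i)) \<le> M"
        unfolding M_def using that(2) by (intro member_le_sum) auto
      with that show ?thesis
        unfolding S_def by fastforce
    qed
    then have "S p \<subseteq> {s. set s \<subseteq> {0..M} \<and> length s = 2 * N}"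
      unfolding S_def by (fastforce simp: in_set_conv_nth)
    with finite_lists_length_eq[of "{0..M}" "2 * N"] show ?thesis
      by (auto intro: finite_subset)
  qed
  with fin_paths have "finite (SIGMA p:{p. length p = 2 * N}. S p)"
    by (intro finite_SigmaI) auto
  moreover have "path_diagrams pos N \<subseteq> (SIGMA p:{p. length p = 2 * N}. S p)"
    unfolding path_diagrams_def S_def dyck_path_def by auto
  ultimately show ?thesis
    by (rule finite_subset[rotated])
qed

fun pos' :: "label \<Rightarrow> nat" where
  "pos' (A j) = j"
| "pos' (B k) = k - 1"

definition num_diagrams :: "nat \<Rightarrow> nat \<Rightarrow> nat" where
  "num_diagrams N m = card {(p, s) \<in> path_diagrams pos' N. sum_list s = int m}"

text \<open>The outer variable is \<open>t\<close> and the inner variable is \<open>q\<close>.\<close>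

definition G' :: "rat fps fps" where
  "G' = Abs_fps (\<lambda>n. if even n then Abs_fps (\<lambda>m. of_nat (num_diagrams (n div 2) m)) else 0)"

end

theory Submission imports Defs begin

text \<open>
  After clearing the factor \<open>(1 - q)\<^sup>2\<^sup>N\<close>, the coefficient is the \<open>2N\<close>-th moment of the orthogonal
  polynomials with recurrence coefficients \<open>\<lambda>\<^sub>h = (1 - q\<^sup>h)\<^sup>2\<close>. Expanding \<open>x\<^sup>2\<^sup>N\<close> in Chebyshev
  polynomials \<open>U\<^sub>2\<^sub>m\<close> produces the ballot numbers, so it remains to find the value of the moment
  functional on \<open>U\<^sub>2\<^sub>m\<close>. Its values on the continuous \<open>q\<close>-Hermite polynomials are products, which turns
  the value on \<open>U\<^sub>2\<^sub>m\<close> into a single \<open>q\<close>-hypergeometric sum. That sum and the truncated theta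
  series of the statement satisfy the same three-term recurrence in \<open>m\<close>.
\<close>

section \<open>Generating functions of path diagrams\<close>

lemma height_0 [simp]: "height p 0 = 0"
  by (simp add: height_def)

lemma height_Cons_Suc [simp]: "height (u # p) (Suc i) = rise u + height p i"
  by (simp add: height_def)

text \<open>An arbitrary starting height \<open>h\<close> permits recursion on the first step. The
  strict bound for \<open>Down\<close> expresses \<open>pos' (B h) = h - 1\<close> and also excludes
  down steps from height 0.\<close>

fun diagram_from :: "nat \<Rightarrow> step list \<Rightarrow> int list \<Rightarrow> bool" where
  "diagram_from h [] [] \<longleftrightarrow> h = 0"
| "diagram_from h (Up # p) (v # s) \<longleftrightarrow> 0 \<le> v \<and> v \<le> int h \<and> diagram_from (Suc h) p s"
| "diagram_from h (Down # p) (v # s) \<longleftrightarrow> 0 \<le> v \<and> v < int h \<and> diagram_from (h - 1) p s"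
| "diagram_from h _ _ \<longleftrightarrow> False"

lemma diagram_from_iff:
  "diagram_from h p s \<longleftrightarrow> length s = length p
     \<and> (\<forall>i<Suc (length p). int h + height p i \<ge> 0) \<and> int h + height p (length p) = 0
     \<and> (\<forall>i<length p. 0 \<le> s ! i \<and>
         s ! i \<le> int (pos' (case p ! i of Up \<Rightarrow> A (nat (int h + height p i))
                                        | Down \<Rightarrow> B (nat (int h + height p i)))))"
proof (induction h p s rule: diagram_from.induct)
  case (2 h p v s)
  have "int (Suc h) + x = int h + (1 + x)" for x by simp
  note IH = 2[unfolded this]
  show ?case by (auto simp: All_less_Suc2 IH cong del: step.case_cong_weak)
next
  case (3 h p v s)
  show ?case
  proof (cases "h = 0")
    case True
    \<comment> \<open>On the left no \<open>v\<close> qualifies; on the right the height after one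
      step would be -1.\<close>
    then show ?thesis by (auto simp: All_less_Suc2)
  next
    case False
    then obtain k where h: "h = Suc k" using not0_implies_Suc by blast
    have "int k + x = int (Suc k) + (- 1 + x)" for x by simp
    note IH = 3[unfolded h diff_Suc_1 this]
    show ?thesis unfolding h by (auto simp: All_less_Suc2 IH cong del: step.case_cong_weak)
  qed
qed simp_all

definition diagrams :: "nat \<Rightarrow> nat \<Rightarrow> (step list \<times> int list) set" where
  "diagrams n h = {(p, s). length p = n \<and> diagram_from h p s}"

lemma height_length: "height p (length p) = int (count_list p Up) - int (count_list p Down)"
proof (induction p)
  case (Cons u p)
  then show ?case by (cases u) auto
qed simp

lemma length_eq_count: "length p = count_list p Up + count_list p Down"
proof (induction p)
  case (Cons u p)
  then show ?case by (cases u) auto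
qed simp

lemma path_diagrams_eq: "path_diagrams pos' N = diagrams (2 * N) 0"
proof -
  have "dyck_path N p \<longleftrightarrow> length p = 2 * N \<and> height p (length p) = 0
      \<and> (\<forall>i<Suc (length p). height p i \<ge> 0)" for p
    using height_length[of p] length_eq_count[of p] by (auto simp: dyck_path_def less_Suc_eq_le)
  then show ?thesis
    unfolding path_diagrams_def diagrams_def diagram_from_iff of_nat_0 add_0
    by (auto simp: dyck_word_def step_label_def)
qed

lemma diagrams_0: "diagrams 0 h = (if h = 0 then {([], [])} else {})"
proof -
  have "diagram_from h [] s \<longleftrightarrow> h = 0 \<and> s = []" for s
    by (cases s) auto
  then show ?thesis by (auto simp: diagrams_def)
qed

definition cons_diagram :: "step \<Rightarrow> nat \<times> step list \<times> int list \<Rightarrow> step list \<times> int list" where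
  "cons_diagram u = (\<lambda>(v, p, s). (u # p, int v # s))"

lemma diagrams_Suc:
  "diagrams (Suc n) h = cons_diagram Up ` ({..h} \<times> diagrams n (Suc h))
     \<union> cons_diagram Down ` ({..<h} \<times> diagrams n (h - 1))"
proof (intro set_eqI iffI)
  fix x assume x: "x \<in> diagrams (Suc n) h"
  obtain p s where [simp]: "x = (p, s)" by (cases x)
  from x have len: "length p = Suc n" and d: "diagram_from h p s" by (auto simp: diagrams_def)
  from len obtain u p' where p: "p = u # p'" "length p' = n" by (cases p) auto
  from d p obtain v s' where s: "s = v # s'" by (cases s; cases u) auto
  have "v \<ge> 0" using d p s by (cases u) auto
  then obtain k where v: "v = int k" using nonneg_int_cases by blast
  show "x \<in> cons_diagram Up ` ({..h} \<times> diagrams n (Suc h))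
     \<union> cons_diagram Down ` ({..<h} \<times> diagrams n (h - 1))"
  proof (cases u)
    case Up
    then have "x = cons_diagram Up (k, p', s')" "(k, p', s') \<in> {..h} \<times> diagrams n (Suc h)"
      using d p s v by (auto simp: cons_diagram_def diagrams_def)
    then show ?thesis by blast
  next
    case Down
    then have "x = cons_diagram Down (k, p', s')" "(k, p', s') \<in> {..<h} \<times> diagrams n (h - 1)"
      using d p s v by (auto simp: cons_diagram_def diagrams_def)
    then show ?thesis by blast
  qed
qed (auto simp: cons_diagram_def diagrams_def)

lemma inj_cons_diagram: "inj_on (cons_diagram u) D"
  by (auto simp: inj_on_def cons_diagram_def)

lemma finite_diagrams: "finite (diagrams n h)"
  by (induction n arbitrary: h) (auto simp: diagrams_0 diagrams_Suc)

lemma diagram_sum_nonneg: "diagram_from h p s \<Longrightarrow> sum_list s \<ge> 0"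
  by (induction h p s rule: diagram_from.induct) auto

text \<open>A general semiring lets \<open>q\<close> be the indeterminate of power series and also
  that of Laurent series, where the closed form lives.\<close>

definition diagram_gf :: "nat \<Rightarrow> nat \<Rightarrow> 'a::comm_semiring_1 \<Rightarrow> 'a" where
  "diagram_gf n h q = (\<Sum>(p, s)\<in>diagrams n h. q ^ nat (sum_list s))"

lemma diagram_gf_0: "diagram_gf 0 h q = (if h = 0 then 1 else 0)"
  by (simp add: diagram_gf_def diagrams_0)

text \<open>Split off the first step: the geometric sums collect the values allowed there. At
  \<open>h = 0\<close> the second one is empty, so the truncated \<open>h - 1\<close> is
  harmless.\<close>

lemma diagram_gf_Suc:
  "diagram_gf (Suc n) h q = (\<Sum>v\<le>h. q ^ v) * diagram_gf n (Suc h) q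
     + (\<Sum>v<h. q ^ v) * diagram_gf n (h - 1) q"
proof -
  let ?w = "\<lambda>(p :: step list, s). q ^ nat (sum_list s)"
  have cons: "sum ?w (cons_diagram u ` (V \<times> diagrams n k)) = (\<Sum>v\<in>V. q ^ v) * diagram_gf n k q"
    for u V k
  proof -
    have "sum ?w (cons_diagram u ` (V \<times> diagrams n k))
        = (\<Sum>(v, p, s)\<in>V \<times> diagrams n k. q ^ v * q ^ nat (sum_list s))"
      unfolding sum.reindex[OF inj_cons_diagram]
      by (rule sum.cong)
        (auto simp: cons_diagram_def diagrams_def nat_add_distrib power_add
          dest: diagram_sum_nonneg)
    then show ?thesis
      by (simp add: sum_product diagram_gf_def sum.cartesian_product case_prod_unfold)
  qed
  have "sum ?w (diagrams (Suc n) h) = sum ?w (cons_diagram Up ` ({..h} \<times> diagrams n (Suc h)))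
      + sum ?w (cons_diagram Down ` ({..<h} \<times> diagrams n (h - 1)))"
    unfolding diagrams_Suc
    by (rule sum.union_disjoint) (auto simp: finite_diagrams cons_diagram_def)
  then show ?thesis unfolding cons by (simp add: diagram_gf_def)
qed

lemma G'_nth_even: "fps_nth G' (2 * N) = diagram_gf (2 * N) 0 fps_X"
proof (rule fps_ext)
  fix m
  have "fps_nth (diagram_gf (2 * N) 0 fps_X :: rat fps) m
      = (\<Sum>(p, s)\<in>diagrams (2 * N) 0. if sum_list s = int m then 1 else 0)"
    unfolding diagram_gf_def fps_sum_nth
    by (rule sum.cong) (auto simp: diagrams_def fps_X_power_nth dest: diagram_sum_nonneg)
  also have "\<dots> = of_nat (num_diagrams N m)"
    by (simp add: num_diagrams_def path_diagrams_eq case_prod_unfold sum.If_cases finite_diagrams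
        Int_def conj_commute)
  finally show "fps_nth (fps_nth G' (2 * N)) m = fps_nth (diagram_gf (2 * N) 0 fps_X) m"
    by (simp add: G'_def)
qed

lemma fps_to_fls_diagram_gf:
  "fps_to_fls (diagram_gf n h f) = diagram_gf n h (fps_to_fls (f :: 'a::comm_semiring_1 fps))"
proof -
  have p: "fps_to_fls (f ^ k) = fps_to_fls f ^ k" for k
    by (induction k) (simp_all add: fls_times_fps_to_fls)
  have s: "fps_to_fls (\<Sum>x\<in>S. F x) = (\<Sum>x\<in>S. fps_to_fls (F x :: 'a fps))"
    if "finite S" for S :: "(step list \<times> int list) set" and F
    using that by (induction S rule: finite_induct) simp_all
  show ?thesis
    by (simp add: diagram_gf_def s finite_diagrams p case_prod_unfold)
qed

section \<open>The moment functional on Chebyshev polynomials\<close>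

locale not_root_of_unity =
  fixes q :: "'a :: field"
  assumes power_neq_1: "n > 0 \<Longrightarrow> q ^ n \<noteq> 1"
begin

text \<open>In q-Pochhammer notation \<open>qfact n\<close> is (q;q)_n and \<open>q2fact n\<close>
  is (q^2;q^2)_n; \<open>qtri n\<close> is q^(n(n+1)/2), as a product to avoid division in the
  exponent.\<close>

definition qfact :: "nat \<Rightarrow> 'a" where
  "qfact n = (\<Prod>i=1..n. 1 - q ^ i)"

definition q2fact :: "nat \<Rightarrow> 'a" where
  "q2fact n = (\<Prod>i=1..n. 1 - q ^ (2 * i))"

definition qtri :: "nat \<Rightarrow> 'a" where
  "qtri n = (\<Prod>i=1..n. q ^ i)"

lemma qfact_0 [simp]: "qfact 0 = 1" and q2fact_0 [simp]: "q2fact 0 = 1"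
  and qtri_0 [simp]: "qtri 0 = 1"
  by (simp_all add: qfact_def q2fact_def qtri_def)

lemma qfact_Suc: "qfact (Suc n) = (1 - q ^ Suc n) * qfact n"
  and q2fact_Suc: "q2fact (Suc n) = (1 - q ^ (2 * Suc n)) * q2fact n"
  and qtri_Suc: "qtri (Suc n) = q ^ Suc n * qtri n"
  by (simp_all add: qfact_def q2fact_def qtri_def mult.commute)

lemma one_minus_power_neq_0 [simp]: "n > 0 \<Longrightarrow> 1 - q ^ n \<noteq> 0"
  using power_neq_1[of n] by simp

lemma qfact_neq_0 [simp]: "qfact n \<noteq> 0" and q2fact_neq_0 [simp]: "q2fact n \<noteq> 0"
  using power_neq_1 by (auto simp: qfact_def q2fact_def)

definition shift :: "(nat \<Rightarrow> 'a) \<Rightarrow> nat \<Rightarrow> 'a" where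
  "shift f h = f (Suc h) + (1 - q ^ h)\<^sup>2 * f (h - 1)"

lemma shift_sum: "shift (\<lambda>h. \<Sum>i\<in>I. c i * f i h) h = (\<Sum>i\<in>I. c i * shift (f i) h)"
  unfolding shift_def sum_distrib_left sum.distrib[symmetric]
  by (rule sum.cong) (simp_all add: algebra_simps)

text \<open>
  Let \<open>P\<^sub>h\<close> be the monic polynomials with \<open>x P\<^sub>h = P\<^sub>h\<^sub>+\<^sub>1 + (1 - q\<^sup>h)\<^sup>2 P\<^sub>h\<^sub>-\<^sub>1\<close>, and \<open>L\<close> the linear functional
  with \<open>L 1 = 1\<close> and \<open>L P\<^sub>h = 0\<close> for \<open>h > 0\<close>. A polynomial \<open>f\<close> is encoded by the sequence
  \<open>h \<mapsto> L (f P\<^sub>h)\<close>, so that \<open>shift\<close> is multiplication by \<open>x\<close>, \<open>hermite n\<close> is the continuous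
  \<open>q\<close>-Hermite polynomial \<open>H\<^sub>n\<close> (so \<open>hermite 0\<close> is the constant \<open>1\<close>), and \<open>cheb k\<close> below is the
  Chebyshev polynomial \<open>U\<^sub>k\<close>.
\<close>

definition hermite :: "nat \<Rightarrow> nat \<Rightarrow> 'a" where
  "hermite n h = (if h \<le> n \<and> even (n - h)
     then qfact n * qfact h * (-q) ^ ((n - h) div 2) / q2fact ((n - h) div 2) else 0)"

lemma hermite_eq: "hermite (h + 2 * i) h = qfact (h + 2 * i) * qfact h * (-q) ^ i / q2fact i"
  by (simp add: hermite_def)

text \<open>The recurrence x H_n = H_(n+1) + (1 - q^n) H_(n-1) in this encoding. At
  \<open>n = 0\<close> the truncated index carries the factor 0.\<close>

lemma shift_hermite:
  "shift (hermite n) h = hermite (Suc n) h + (1 - q ^ n) * hermite (n - 1) h"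
proof -
  \<comment> \<open>Beyond the support or in the wrong parity all terms vanish; at
    \<open>h = Suc n\<close> only the leading terms survive; the last case is generic.\<close>
  consider "Suc n < h" | "h \<le> Suc n" "odd (Suc n - h)" | "h = Suc n"
    | i where "n = h + 2 * i + 1"
  proof -
    have "\<exists>i. n = h + 2 * i + 1" if "h \<le> Suc n" "even (Suc n - h)" "h \<noteq> Suc n"
    proof -
      from that obtain j where j: "Suc n - h = 2 * j" by (elim evenE)
      with that have "j > 0" by (cases j) auto
      with j that show ?thesis by (intro exI[of _ "j - 1"]) simp
    qed
    then show thesis using that by (meson not_le)
  qed
  then show ?thesis
  proof cases
    case 1
    then show ?thesis by (auto simp: shift_def hermite_def)
  next
    case 2
    then show ?thesis
      by (cases h; cases n) (auto simp: shift_def hermite_def Suc_diff_le)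
  next
    case 3
    then show ?thesis
      using hermite_eq[of n 0] hermite_eq[of "Suc n" 0]
      by (simp add: shift_def qfact_Suc power2_eq_square) (simp add: hermite_def)
  next
    case (4 i)
    have up: "hermite n (Suc h) = qfact n * qfact (Suc h) * (-q) ^ i / q2fact i"
      using hermite_eq[of "Suc h" i] 4 by simp
    have down: "(1 - q ^ h)\<^sup>2 * hermite n (h - 1)
        = (1 - q ^ h) * (qfact n * qfact h * (-q) ^ Suc i / q2fact (Suc i))"
    proof (cases h)
      case (Suc k)
      then show ?thesis
        using hermite_eq[of k "Suc i"] 4 by (simp add: power2_eq_square qfact_Suc)
    qed simp
    have prev: "(1 - q ^ n) * hermite (n - 1) h = qfact n * qfact h * (-q) ^ i / q2fact i"
      using hermite_eq[of h i] qfact_Suc[of "n - 1"] 4 by simp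
    have suc: "hermite (Suc n) h = qfact (Suc n) * qfact h * (-q) ^ Suc i / q2fact (Suc i)"
      using hermite_eq[of h "Suc i"] 4 by simp
    \<comment> \<open>With denominator \<open>q2fact (Suc i)\<close> every term is a polynomial
      multiple of \<open>B\<close>.\<close>
    define B where "B = qfact n * qfact h * (-q) ^ i / q2fact (Suc i)"
    have B: "qfact n * qfact h * (-q) ^ i / q2fact i = B * (1 - q ^ (2 * Suc i))"
      unfolding B_def q2fact_Suc using one_minus_power_neq_0[of "2 * Suc i"]
      by (simp del: one_minus_power_neq_0)
    have up': "hermite n (Suc h) = (1 - q ^ Suc h) * (B * (1 - q ^ (2 * Suc i)))"
      unfolding B[symmetric] up by (simp add: qfact_Suc)
    have down': "(1 - q ^ h)\<^sup>2 * hermite n (h - 1) = (1 - q ^ h) * (-q * B)"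
      unfolding down by (simp add: B_def)
    have suc': "hermite (Suc n) h = (1 - q ^ Suc n) * (-q * B)"
      unfolding suc by (simp add: B_def qfact_Suc)
    have "shift (hermite n) h
        = B * ((1 - q ^ Suc h) * (1 - q ^ (2 * Suc i)) - q * (1 - q ^ h))"
      unfolding shift_def down' up' by (simp add: algebra_simps)
    also have "\<dots> = B * (-q * (1 - q ^ Suc n) + (1 - q ^ (2 * Suc i)))"
      by (simp add: 4 algebra_simps power_add)
    also have "\<dots> = hermite (Suc n) h + (1 - q ^ n) * hermite (n - 1) h"
      unfolding prev suc' B by (simp add: algebra_simps)
    finally show ?thesis .
  qed
qed

section \<open>Chebyshev polynomials in the continuous q-Hermite basis\<close>

definition cheb_coeff :: "nat \<Rightarrow> nat \<Rightarrow> 'a" where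
  "cheb_coeff k j = (if 2 * j \<le> k
     then (-1) ^ j * qtri j * qfact (k - j) / (qfact j * qfact (k - 2 * j)) else 0)"

lemma cheb_coeff_eq:
  "cheb_coeff (2 * j + d) j = (-1) ^ j * qtri j * qfact (j + d) / (qfact j * qfact d)"
  by (simp add: cheb_coeff_def)

text \<open>\<open>cheb_coeff k j\<close> is (-1)^j q^(j(j+1)/2) times the Gaussian binomial of k-j
  over j. The identity compares the coefficients of H_(k-2j) in x U_(k+1) = U_(k+2) + U_k.\<close>

lemma cheb_coeff_rec:
  "cheb_coeff (k + 2) (Suc j) + cheb_coeff k j
     = cheb_coeff (k + 1) (Suc j) + (1 - q ^ (k + 1 - 2 * j)) * cheb_coeff (k + 1) j"
proof -
  \<comment> \<open>In the first two cases all terms vanish, at \<open>k + 1 = 2 * j\<close> through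
    1 - q^0. At \<open>k = 2 * j\<close> one coefficient lies outside its support.\<close>
  consider "k + 1 < 2 * j" | "k + 1 = 2 * j" | "k = 2 * j" | d where "k = 2 * j + Suc d"
  proof -
    have "k = 2 * j + Suc (k - 2 * j - 1)" if "2 * j < k"
      using that by simp
    then show thesis using that by (metis Suc_eq_plus1 less_Suc_eq nat_neq_iff not_less_eq)
  qed
  then show ?thesis
  proof cases
    case 3
    define E where "E = (-1) ^ j * qtri j"
    have q2: "cheb_coeff (k + 2) (Suc j) = - (q ^ Suc j) * E"
      using cheb_coeff_eq[of "Suc j" 0] 3 by (simp add: E_def qtri_Suc)
    have q0: "cheb_coeff k j = E"
      using cheb_coeff_eq[of j 0] 3 by (simp add: E_def)
    have q1: "cheb_coeff (k + 1) (Suc j) = 0"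
      using 3 by (simp add: cheb_coeff_def)
    have q3: "(1 - q ^ (k + 1 - 2 * j)) * cheb_coeff (k + 1) j = (1 - q ^ Suc j) * E"
      using cheb_coeff_eq[of j 1] 3 one_minus_power_neq_0[of 1]
      by (simp add: E_def qfact_Suc[of j] qfact_Suc[of 0] del: one_minus_power_neq_0)
    show ?thesis unfolding q0 q1 q2 q3 by (simp add: algebra_simps)
  next
    case (4 d)
    define E where "E = (-1) ^ j * qtri j * qfact (j + d + 1) / (qfact (Suc j) * qfact (Suc d))"
    have q2: "cheb_coeff (k + 2) (Suc j) = - (q ^ Suc j * (1 - q ^ (j + d + 2))) * E"
      using cheb_coeff_eq[of "Suc j" "Suc d"] 4 by (simp add: E_def qtri_Suc qfact_Suc)
    have q0: "cheb_coeff k j = (1 - q ^ Suc j) * E"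
      using cheb_coeff_eq[of j "Suc d"] 4 one_minus_power_neq_0[of "Suc j"]
      by (simp add: E_def qfact_Suc[of j] del: one_minus_power_neq_0 power_Suc)
    have q1: "cheb_coeff (k + 1) (Suc j) = - (q ^ Suc j * (1 - q ^ Suc d)) * E"
      using cheb_coeff_eq[of "Suc j" d] 4 one_minus_power_neq_0[of "Suc d"]
      by (simp add: E_def qtri_Suc qfact_Suc[of d] power_Suc[of "-1" j]
          del: one_minus_power_neq_0 power_Suc)
    have q3: "(1 - q ^ (k + 1 - 2 * j)) * cheb_coeff (k + 1) j
        = (1 - q ^ (j + d + 2)) * (1 - q ^ Suc j) * E"
      using cheb_coeff_eq[of j "Suc (Suc d)"] 4 one_minus_power_neq_0[of "Suc j"]
        one_minus_power_neq_0[of "Suc (Suc d)"]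
      by (simp add: E_def qfact_Suc[of "Suc d"] qfact_Suc[of "Suc (j + d)"] qfact_Suc[of j]
          del: one_minus_power_neq_0 power_Suc)
    show ?thesis unfolding q0 q1 q2 q3 by (simp add: algebra_simps power_add)
  qed (auto simp: cheb_coeff_def)
qed

definition cheb :: "nat \<Rightarrow> nat \<Rightarrow> 'a" where
  "cheb k h = (\<Sum>j\<le>k. cheb_coeff k j * hermite (k - 2 * j) h)"

text \<open>Padding with zero coefficients gives U_k, U_(k+1) and U_(k+2) a common summation
  range.\<close>

lemma cheb_eq_sum:
  assumes "k \<le> K"
  shows "cheb k h = (\<Sum>j\<le>K. cheb_coeff k j * hermite (k - 2 * j) h)"
  unfolding cheb_def using assms
  by (intro sum.mono_neutral_left) (auto simp: cheb_coeff_def)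

lemma cheb_0: "cheb 0 = hermite 0"
  by (simp add: fun_eq_iff cheb_def cheb_coeff_def)

lemma shift_cheb_0: "shift (cheb 0) h = cheb 1 h"
  by (simp add: cheb_0 shift_hermite) (simp add: cheb_def cheb_coeff_def)

text \<open>Together with \<open>shift_cheb_0\<close> this recurrence identifies \<open>cheb\<close>
  with the Chebyshev polynomials.\<close>

lemma shift_cheb: "shift (cheb (k + 1)) h = cheb (k + 2) h + cheb k h"
proof -
  let ?e = "\<lambda>j. hermite (k - 2 * j) h"
  have "cheb (k + 1) =
      (\<lambda>h. \<Sum>j\<le>k+2. cheb_coeff (k + 1) j * hermite (k + 1 - 2 * j) h)"
    by (rule ext, rule cheb_eq_sum) simp
  then have "shift (cheb (k + 1)) h =
      (\<Sum>j\<le>k+2. cheb_coeff (k + 1) j * shift (hermite (k + 1 - 2 * j)) h)"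
    by (simp only: shift_sum)
  also have "\<dots> = (\<Sum>j\<le>k+2. cheb_coeff (k + 1) j * hermite (k + 2 - 2 * j) h)
      + (\<Sum>j\<le>k+2. (1 - q ^ (k + 1 - 2 * j)) * cheb_coeff (k + 1) j * ?e j)"
    unfolding sum.distrib[symmetric]
  proof (rule sum.cong)
    fix j
    show "cheb_coeff (k + 1) j * shift (hermite (k + 1 - 2 * j)) h =
        cheb_coeff (k + 1) j * hermite (k + 2 - 2 * j) h
        + (1 - q ^ (k + 1 - 2 * j)) * cheb_coeff (k + 1) j * ?e j"
    proof (cases "2 * j \<le> k + 1")
      case True
      then show ?thesis by (simp add: shift_hermite Suc_diff_le algebra_simps)
    next
      case False
      then show ?thesis by (simp add: cheb_coeff_def)
    qed
  qed simp
  \<comment> \<open>The term j = 0 is H_(k+2) itself; shifting the others by one makes both sums run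
    over H_(k-2j).\<close>
  also have "(\<Sum>j\<le>k+2. cheb_coeff (k + 1) j * hermite (k + 2 - 2 * j) h) =
      hermite (k + 2) h + (\<Sum>j\<le>k+2. cheb_coeff (k + 1) (Suc j) * ?e j)"
    using sum.atMost_Suc_shift[of "\<lambda>j. cheb_coeff (k + 1) j * hermite (k + 2 - 2 * j) h" "k + 2"]
    by (simp add: cheb_coeff_def)
  also have "hermite (k + 2) h + (\<Sum>j\<le>k+2. cheb_coeff (k + 1) (Suc j) * ?e j)
      + (\<Sum>j\<le>k+2. (1 - q ^ (k + 1 - 2 * j)) * cheb_coeff (k + 1) j * ?e j)
      = hermite (k + 2) h + (\<Sum>j\<le>k+2. (cheb_coeff (k + 2) (Suc j) + cheb_coeff k j) * ?e j)"
    unfolding cheb_coeff_rec by (simp add: sum.distrib distrib_right)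
  also have "\<dots> = (hermite (k + 2) h + (\<Sum>j\<le>k+2. cheb_coeff (k + 2) (Suc j) * ?e j)) + cheb k h"
    by (simp add: sum.distrib distrib_right cheb_eq_sum[of k "k + 2"])
  also have "hermite (k + 2) h + (\<Sum>j\<le>k+2. cheb_coeff (k + 2) (Suc j) * ?e j) = cheb (k + 2) h"
    using sum.atMost_Suc_shift[of "\<lambda>j. cheb_coeff (k + 2) j * hermite (k + 2 - 2 * j) h" "k + 2"]
      cheb_eq_sum[of "k + 2" "k + 3" h]
    by (simp add: cheb_coeff_def numeral_3_eq_3)
  finally show ?thesis .
qed

section \<open>The moment functional on U_(2m) as a q-hypergeometric sum, and its recurrence\<close>

definition secant_term :: "nat \<Rightarrow> nat \<Rightarrow> 'a" where
  "secant_term m i = qtri (m - i) * q ^ i * qfact (m + i) / (qfact (m - i) * q2fact i)"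

definition secant_sum :: "nat \<Rightarrow> 'a" where
  "secant_sum m = (\<Sum>i\<le>m. secant_term m i)"

text \<open>Since P_0 = 1, entry 0 of an encoding is the value of L. \<open>secant_term m i\<close>
  is the contribution of H_(2i), so j = m - i, without the sign (-1)^m.\<close>

lemma cheb_even_0: "cheb (2 * m) 0 = (-1) ^ m * secant_sum m"
proof -
  have term_eq: "cheb_coeff (2 * m) (m - i) * hermite (2 * i) 0 = (-1) ^ m * secant_term m i"
    if i: "i \<le> m" for i
  proof -
    obtain d where m: "m = i + d" using le_Suc_ex[OF i] by blast
    have "cheb_coeff (2 * m) (m - i)
        = (-1) ^ d * qtri d * qfact (m + i) / (qfact d * qfact (2 * i))"
      using cheb_coeff_eq[of d "2 * i"] m by (simp add: mult_2 add_ac)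
    moreover have "hermite (2 * i) 0 = qfact (2 * i) * (-1) ^ i * q ^ i / q2fact i"
      using hermite_eq[of 0 i] by (simp add: power_minus[of q])
    ultimately show ?thesis
      using m by (simp add: secant_term_def power_add)
  qed
  have "cheb (2 * m) 0 = (\<Sum>j\<le>m. cheb_coeff (2 * m) j * hermite (2 * m - 2 * j) 0)"
    unfolding cheb_def by (intro sum.mono_neutral_right) (auto simp: cheb_coeff_def)
  also have "\<dots> = (\<Sum>i\<le>m. cheb_coeff (2 * m) (m - i) * hermite (2 * i) 0)"
    by (rule sum.reindex_bij_witness[of _ "\<lambda>i. m - i" "\<lambda>i. m - i"]) (auto simp: diff_mult_distrib2)
  also have "\<dots> = (-1) ^ m * secant_sum m"
    by (simp add: term_eq secant_sum_def sum_distrib_left)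
  finally show ?thesis .
qed

definition secant_op :: "nat \<Rightarrow> (nat \<Rightarrow> 'a) \<Rightarrow> 'a" where
  "secant_op m f = f (m + 2) - q * (1 - q ^ (2 * m + 3)) * f (m + 1) - q ^ (2 * m + 3) * f m"

definition certificate :: "nat \<Rightarrow> nat \<Rightarrow> 'a" where
  "certificate m i = (1 - q ^ (2 * m + 3)) * q ^ (m + 2) * qtri (m - i) * qfact (m + i + 1)
     / (qfact (m - i + 1) * q2fact i)"

text \<open>
  Wilf--Zeilberger pair: the two parts together say that \<open>secant_op m\<close> applied to the \<open>n\<close>-th summand is
  \<open>certificate m (n - 1) - certificate m n\<close>. The middle expression vanishes at \<open>n = 0\<close>, where
  \<open>n - 1\<close> is truncated.
\<close>

lemma secant_op_term:
  fixes n d :: nat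
  defines "T \<equiv> qtri d * q ^ n * qfact (2 * n + d) / (qfact (d + 2) * q2fact n)"
    and "m \<equiv> n + d"
  shows "secant_op m (\<lambda>m. secant_term m n)
           = T * (1 - q ^ (2 * m + 3)) * q ^ (2 * d + 3) * (1 - q ^ (2 * n)) - certificate m n"
    and "n > 0 \<Longrightarrow>
      T * (1 - q ^ (2 * m + 3)) * q ^ (2 * d + 3) * (1 - q ^ (2 * n)) = certificate m (n - 1)"
proof -
  have idx: "m + 2 - n = Suc (Suc d)" "m + 2 + n = Suc (Suc (2 * n + d))"
    "m + 1 - n = Suc d" "m + 1 + n = Suc (2 * n + d)"
    "m - n = d" "m + n = 2 * n + d" "m - n + 1 = Suc d" "m + n + 1 = Suc (2 * n + d)"
    by (simp_all add: m_def)
  have d2: "qfact (d + 2) = (1 - q ^ (d + 2)) * ((1 - q ^ (d + 1)) * qfact d)"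
    and d1: "qfact (Suc d) = (1 - q ^ (d + 1)) * qfact d"
    and e1: "qfact (Suc (2 * n + d)) = (1 - q ^ (2 * n + d + 1)) * qfact (2 * n + d)"
    by (simp_all add: qfact_Suc del: power_Suc)
  note nz = one_minus_power_neq_0[of "d + 2"] one_minus_power_neq_0[of "d + 1"]
  have t2: "secant_term (m + 2) n
      = T * q ^ (2 * d + 3) * (1 - q ^ (2 * n + d + 1)) * (1 - q ^ (2 * n + d + 2))"
  proof -
    have "q ^ (2 * d + 3) = q ^ Suc (Suc d) * q ^ Suc d"
      unfolding power_add[symmetric] by (rule arg_cong[where f = "(^) q"]) simp
    then show ?thesis
      unfolding secant_term_def idx T_def
      by (simp add: qtri_Suc qfact_Suc[of "Suc (2 * n + d)"] qfact_Suc[of "2 * n + d"]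
          del: power_Suc)
  qed
  have t1: "secant_term (m + 1) n
      = T * q ^ (d + 1) * (1 - q ^ (2 * n + d + 1)) * (1 - q ^ (d + 2))"
    unfolding secant_term_def idx T_def d2 d1 e1 using nz
    by (simp add: qtri_Suc mult_ac del: one_minus_power_neq_0 power_Suc)
  have t0: "secant_term m n = T * (1 - q ^ (d + 1)) * (1 - q ^ (d + 2))"
    unfolding secant_term_def idx T_def d2 d1 using nz
    by (simp add: mult_ac del: one_minus_power_neq_0 power_Suc)
  have c: "certificate m n = T * (1 - q ^ (2 * m + 3)) * q ^ (d + 2)
      * (1 - q ^ (2 * n + d + 1)) * (1 - q ^ (d + 2))"
  proof -
    have "q ^ (m + 2) = q ^ n * q ^ (d + 2)" by (simp add: m_def power_add)
    then show ?thesis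
      unfolding certificate_def idx Suc_eq_plus1[symmetric] T_def d2 d1 e1 using nz
      by (simp add: mult_ac del: one_minus_power_neq_0 power_Suc)
  qed
  \<comment> \<open>All terms are now \<open>T\<close> times polynomials in q, x and s, so a
    polynomial identity remains.\<close>
  define x where "x = q ^ d"
  define s where "s = q ^ n"
  have pw: "q ^ (2 * d + 3) = q ^ 3 * x\<^sup>2" "q ^ (d + 1) = q * x" "q ^ (d + 2) = q\<^sup>2 * x"
    "q ^ (2 * n + d + 1) = q * x * s\<^sup>2" "q ^ (2 * n + d + 2) = q\<^sup>2 * x * s\<^sup>2"
    "q ^ (2 * n) = s\<^sup>2" "q ^ (2 * m + 3) = q ^ 3 * x\<^sup>2 * s\<^sup>2"
    by (simp_all add: x_def s_def m_def power_add power_mult[symmetric] mult_ac)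
      (simp_all add: power_mult mult_2 power_add power2_eq_square numeral_3_eq_3 mult_ac)
  show "secant_op m (\<lambda>m. secant_term m n)
           = T * (1 - q ^ (2 * m + 3)) * q ^ (2 * d + 3) * (1 - q ^ (2 * n)) - certificate m n"
    unfolding secant_op_def t0 t1 t2 c pw by algebra
  show "T * (1 - q ^ (2 * m + 3)) * q ^ (2 * d + 3) * (1 - q ^ (2 * n)) = certificate m (n - 1)"
    if n0: "n > 0"
  proof -
    obtain k where n: "n = Suc k" using n0 gr0_conv_Suc by blast
    have idx: "m - k = Suc d" "m + k + 1 = 2 * n + d" "Suc d + 1 = d + 2"
      by (simp_all add: m_def n)
    have E: "q ^ n * q ^ (2 * d + 3) = q ^ (m + 2) * q ^ Suc d"
      unfolding power_add[symmetric] by (rule arg_cong[where f = "(^) q"]) (simp add: m_def)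
    have q2: "q2fact n = (1 - q ^ (2 * n)) * q2fact k"
      unfolding n q2fact_Suc ..
    have "T * (1 - q ^ (2 * m + 3)) * q ^ (2 * d + 3) * (1 - q ^ (2 * n))
        = (1 - q ^ (2 * m + 3)) * (q ^ n * q ^ (2 * d + 3)) * qtri d * qfact (2 * n + d)
            * (1 - q ^ (2 * n)) / (qfact (d + 2) * q2fact n)"
      by (simp only: T_def mult_ac times_divide_eq_left times_divide_eq_right)
    also have "\<dots> = certificate m k"
      unfolding E certificate_def idx q2 qtri_Suc
      using one_minus_power_neq_0[of "2 * n"] n0
      by (simp add: mult_ac del: one_minus_power_neq_0 power_Suc)
    finally show ?thesis by (simp add: n)
  qed
qed

lemma secant_op_partial_sum:
  assumes "n \<le> m"
  shows "(\<Sum>i\<le>n. secant_op m (\<lambda>m. secant_term m i)) = - certificate m n"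
  using assms
proof (induction n)
  case 0
  show ?case using secant_op_term(1)[of 0 m] by simp
next
  case (Suc n)
  obtain d where "m = Suc n + d" using le_Suc_ex[OF Suc.prems] by blast
  with Suc show ?case using secant_op_term[of "Suc n" d] by simp
qed

text \<open>Up to i = m the sum telescopes. Of the three summands beyond, one cancels the last
  certificate and the other two cancel each other.\<close>

lemma secant_sum_rec: "secant_op m secant_sum = 0"
proof -
  have f2: "q2fact (m + 1) = (1 - q ^ (2 * m + 2)) * q2fact m"
    "q2fact (m + 2) = (1 - q ^ (2 * m + 4)) * q2fact (m + 1)"
    using q2fact_Suc[of m] q2fact_Suc[of "m + 1"]
    by (simp_all add: numeral_Bit0 del: power_Suc)
  have f: "qfact (2 * m + 4) = (1 - q ^ (2 * m + 4)) * qfact (2 * m + 3)"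
    "qfact (2 * m + 3) = (1 - q ^ (2 * m + 3)) * qfact (2 * m + 2)"
    "qfact (2 * m + 2) = (1 - q ^ (2 * m + 2)) * qfact (2 * m + 1)"
    using qfact_Suc[of "2 * m + 3"] qfact_Suc[of "2 * m + 2"] qfact_Suc[of "2 * m + 1"]
    by (simp_all add: numeral_3_eq_3 numeral_Bit0 del: power_Suc)
  note nz = one_minus_power_neq_0[of "2 * m + 2"] one_minus_power_neq_0[of "2 * m + 4"]
  have idx: "m + 2 - (m + 1) = 1" "m + 2 + (m + 1) = 2 * m + 3" "m + 2 - (m + 2) = 0"
    "m + 2 + (m + 2) = 2 * m + 4" "m + 1 - (m + 1) = 0" "m + 1 + (m + 1) = 2 * m + 2"
    "m - m = 0" "m + m + 1 = 2 * m + 1" "0 + 1 = (1 :: nat)"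
    by simp_all
  have tri: "qtri 1 = q" using qtri_Suc[of 0] by simp
  have b1: "secant_term (m + 2) (m + 1) = certificate m m"
    unfolding secant_term_def certificate_def idx f f2(1) tri using nz
    by (simp del: one_minus_power_neq_0)
  have b2: "secant_term (m + 2) (m + 2) = q * (1 - q ^ (2 * m + 3)) * secant_term (m + 1) (m + 1)"
    unfolding secant_term_def idx f(1,2) f2(2) using nz
    by (simp del: one_minus_power_neq_0)
  have "secant_op m secant_sum = (\<Sum>i\<le>m. secant_op m (\<lambda>m. secant_term m i))
      + secant_term (m + 2) (m + 1) + secant_term (m + 2) (m + 2)
      - q * (1 - q ^ (2 * m + 3)) * secant_term (m + 1) (m + 1)"
    by (simp add: secant_op_def secant_sum_def sum_subtractf sum_distrib_left[symmetric])
      (simp add: algebra_simps)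
  also have "(\<Sum>i\<le>m. secant_op m (\<lambda>m. secant_term m i)) = - certificate m m"
    by (simp add: secant_op_partial_sum)
  finally show ?thesis unfolding b1 b2 by simp
qed

end

section \<open>Expansion of the moments\<close>

text \<open>By reflection, the number of nonnegative paths of 2N unit steps from height 0 to 2m,
  which is the coefficient of U_(2m) in x^(2N).\<close>

definition ballot :: "nat \<Rightarrow> nat \<Rightarrow> 'a::comm_ring_1" where
  "ballot N m = of_nat ((2 * N) choose (N + m)) - of_nat ((2 * N) choose (N + m + 1))"

lemma ballot_Suc_Suc: "ballot (Suc N) (Suc m) = ballot N m + 2 * ballot N (m + 1) + ballot N (m + 2)"
proof -
  have "(2 * Suc N) choose (Suc (Suc j))
      = ((2 * N) choose j) + 2 * ((2 * N) choose Suc j) + ((2 * N) choose Suc (Suc j))" for j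
    by simp
  from this[of "N + m"] this[of "N + m + 1"] show ?thesis
    by (simp add: ballot_def algebra_simps del: binomial_Suc_Suc)
qed

lemma ballot_Suc_0: "ballot (Suc N) 0 = ballot N 0 + ballot N 1"
proof -
  \<comment> \<open>At the boundary Pascal's rule is combined with the symmetry of the two middle
    binomials in row 2N+1.\<close>
  have "(2 * Suc N) choose (Suc N) = 2 * (Suc (2 * N) choose Suc N)"
    using binomial_symmetric[of N "Suc (2 * N)"]
    by (simp del: binomial_Suc_Suc add: binomial_Suc_Suc[of "Suc (2 * N)" N])
  also have "\<dots> = 2 * ((2 * N) choose N) + 2 * ((2 * N) choose Suc N)"
    by simp
  finally have 1: "(2 * Suc N) choose (Suc N) = 2 * ((2 * N) choose N) + 2 * ((2 * N) choose Suc N)" .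
  have "(2 * Suc N) choose (Suc (Suc N))
      = ((2 * N) choose N) + 2 * ((2 * N) choose Suc N) + ((2 * N) choose Suc (Suc N))"
    by simp
  with 1 show ?thesis
    by (simp add: ballot_def algebra_simps del: binomial_Suc_Suc)
qed

lemma ballot_eq_0: "m > N \<Longrightarrow> ballot N m = 0"
  by (simp add: ballot_def binomial_eq_0)

text \<open>Absorption makes the second binomial (N-m)/(N+m+1) times the first.\<close>

lemma ballot_eq:
  "(ballot N m :: 'a::field_char_0)
    = of_nat (2 * m + 1) * of_nat ((2 * N) choose (N + m)) / of_nat (N + m + 1)"
proof (cases "m \<le> N")
  case True
  have "Suc (N + m) * ((2 * N) choose Suc (N + m)) = (2 * N - (N + m)) * ((2 * N) choose (N + m))"
    unfolding binomial_absorption binomial_absorb_comp ..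
  moreover have "2 * N - (N + m) = N - m" by simp
  ultimately have "of_nat (N + m + 1) * (of_nat ((2 * N) choose Suc (N + m)) :: 'a)
      = (of_nat N - of_nat m) * of_nat ((2 * N) choose (N + m))"
    using True by (metis Suc_eq_plus1 of_nat_diff of_nat_mult)
  moreover have "of_nat (N + m + 1) \<noteq> (0 :: 'a)"
    unfolding of_nat_eq_0_iff by simp
  ultimately show ?thesis
    by (simp add: ballot_def field_simps)
qed (simp add: ballot_def binomial_eq_0)

text \<open>Summation by parts: with \<open>y m\<close> for U_(2m) and \<open>z m\<close> for x^2
  U_(2m), multiplication by x^2 moves from the basis to the coefficients. The boundary terms carry
  the induction and vanish for ballot numbers at \<open>n = N\<close>.\<close>

lemma sum_second_difference:
  fixes b y z :: "nat \<Rightarrow> 'a::comm_ring_1"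
  assumes "z 0 = y 1 + y 0" "\<And>m. z (Suc m) = y (m + 2) + 2 * y (m + 1) + y m"
  shows "(\<Sum>m\<le>n. b m * z m) + b (n + 1) * (y n + 2 * y (n + 1)) + b (n + 2) * y (n + 1)
    = (b 0 + b 1) * y 0 + (\<Sum>m\<le>n. (b m + 2 * b (m + 1) + b (m + 2)) * y (m + 1))"
  by (induction n) (simp_all add: assms algebra_simps)

context not_root_of_unity begin

text \<open>The Chebyshev expansion of x^(2N), by repeated multiplication by x^2.\<close>

lemma shift_iterate:
  "(shift ^^ (2 * N)) (hermite 0) h = (\<Sum>m\<le>N. ballot N m * cheb (2 * m) h)"
proof (induction N arbitrary: h)
  case 0
  show ?case by (simp add: ballot_def cheb_0)
next
  case (Suc N)
  let ?y = "\<lambda>m. cheb (2 * m) h"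
  let ?z = "\<lambda>m. shift (shift (cheb (2 * m))) h"
  have shift_add: "shift (\<lambda>h. f h + g h) h = shift f h + shift g h" for f g h
    by (simp add: shift_def algebra_simps)
  have c0: "shift (cheb 0) = cheb 1"
    using shift_cheb_0 by blast
  have c: "shift (cheb (Suc k)) = (\<lambda>h. cheb (Suc (Suc k)) h + cheb k h)" for k
    using shift_cheb[of k] by auto
  have z0: "?z 0 = ?y 1 + ?y 0"
    using shift_cheb[of 0 h] by (simp add: c0 numeral_2_eq_2)
  have zSuc: "?z (Suc m) = ?y (m + 2) + 2 * ?y (m + 1) + ?y m" for m
    using shift_cheb by (simp add: c shift_add)
  have "(shift ^^ (2 * Suc N)) (hermite 0) h = shift (shift ((shift ^^ (2 * N)) (hermite 0))) h"
    by simp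
  also have "\<dots> = shift (shift (\<lambda>h. \<Sum>m\<le>N. ballot N m * cheb (2 * m) h)) h"
    by (simp add: Suc.IH[abs_def])
  also have "\<dots> = (\<Sum>m\<le>N. ballot N m * ?z m)"
    unfolding shift_sum[abs_def] ..
  also have "\<dots> = (ballot N 0 + ballot N 1) * ?y 0
      + (\<Sum>m\<le>N. (ballot N m + 2 * ballot N (m + 1) + ballot N (m + 2)) * ?y (m + 1))"
    using sum_second_difference[of ?z ?y "ballot N" N, OF z0 zSuc]
    by (simp add: ballot_eq_0)
  also have "\<dots> = ballot (Suc N) 0 * ?y 0 + (\<Sum>m\<le>N. ballot (Suc N) (Suc m) * ?y (Suc m))"
    unfolding ballot_Suc_0 ballot_Suc_Suc by simp
  also have "\<dots> = (\<Sum>m\<le>Suc N. ballot (Suc N) m * ?y m)"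
    by (subst sum.atMost_Suc_shift) simp
  finally show ?case .
qed

text \<open>A geometric sum times 1 - q is 1 - q^k, and the \<open>qfact\<close> factors then turn
  the step weights into 1 and (1 - q^h)^2, the coefficients in \<open>shift\<close>.\<close>

lemma diagram_gf_eq_shift:
  "(1 - q) ^ n * qfact h * diagram_gf n h q = (shift ^^ n) (hermite 0) h"
proof (induction n arbitrary: h)
  case 0
  show ?case by (simp add: diagram_gf_0 hermite_def)
next
  case (Suc n)
  have geo: "(1 - q) * (\<Sum>v<k. q ^ v) = 1 - q ^ k" for k
    by (simp add: one_diff_power_eq)
  have "(1 - q) ^ Suc n * qfact h * diagram_gf (Suc n) h q
      = (1 - q) ^ n * qfact h * (((1 - q) * (\<Sum>v<Suc h. q ^ v)) * diagram_gf n (Suc h) q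
        + ((1 - q) * (\<Sum>v<h. q ^ v)) * diagram_gf n (h - 1) q)"
    unfolding diagram_gf_Suc lessThan_Suc_atMost by (simp add: algebra_simps)
  also have "\<dots> = (1 - q) ^ n * qfact (Suc h) * diagram_gf n (Suc h) q
      + (1 - q ^ h)\<^sup>2 * ((1 - q) ^ n * qfact (h - 1) * diagram_gf n (h - 1) q)"
    unfolding geo
    by (cases h) (simp_all add: qfact_Suc algebra_simps power2_eq_square)
  also have "\<dots> = shift ((shift ^^ n) (hermite 0)) h"
    unfolding Suc.IH shift_def ..
  finally show ?case by simp
qed

section \<open>The truncated theta series and the closed form\<close>

lemma theta_Suc:
  fixes m :: nat
  defines "\<theta> \<equiv> \<lambda>m :: nat. \<Sum>l = - int m..int m. (-1) powi l * q powi (- (l\<^sup>2))"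
  shows "\<theta> (Suc m) = \<theta> m + 2 * (-1) ^ Suc m * inverse (q ^ (Suc m)\<^sup>2)"
proof -
  \<comment> \<open>The two new indices contribute equally, whence the factor 2.\<close>
  have "{- int (Suc m)..int (Suc m)}
      = insert (- int (Suc m)) (insert (int (Suc m)) {- int m..int m})" by auto
  moreover have "q powi (- ((int (Suc m))\<^sup>2)) = inverse (q ^ (Suc m)\<^sup>2)"
    by (metis of_nat_power power_int_minus power_int_of_nat)
  moreover have "(-1) powi (int (Suc m)) = (-1 :: 'a) ^ Suc m"
    by (rule power_int_of_nat)
  moreover have "(-1) powi (- int (Suc m)) = (-1 :: 'a) ^ Suc m"
    unfolding power_int_minus power_int_of_nat
    by (simp add: power_inverse[symmetric])
  ultimately show ?thesis
    by (simp add: \<theta>_def del: of_nat_Suc power_Suc)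
qed

lemma secant_sum_eq:
  assumes "q \<noteq> 0"
  shows "(-1) ^ m * secant_sum m
    = q ^ (m\<^sup>2 + m) * (\<Sum>l = - int m..int m. (-1) powi l * q powi (- (l\<^sup>2)))"
proof -
  define c where "c m = q ^ (m\<^sup>2 + m) * (\<Sum>l = - int m..int m. (-1) powi l * q powi (- (l\<^sup>2)))"
    for m :: nat
  have c_Suc: "c (Suc m) = q ^ (2 * m + 2) * c m + 2 * (-1) ^ Suc m * q ^ Suc m" for m
  proof -
    have "q ^ ((Suc m)\<^sup>2 + Suc m) = q ^ (2 * m + 2) * q ^ (m\<^sup>2 + m)"
      unfolding power_add[symmetric]
      by (rule arg_cong[where f = "(^) q"]) (simp add: power2_eq_square)
    moreover have "q ^ ((Suc m)\<^sup>2 + Suc m) * inverse (q ^ (Suc m)\<^sup>2) = q ^ Suc m"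
      unfolding power_add using assms by simp
    ultimately show ?thesis
      unfolding c_def theta_Suc by (simp add: algebra_simps del: power_Suc)
  qed
  have c0: "c 0 = 1" by (simp add: c_def)
  \<comment> \<open>The recurrence has order two, so the induction carries consecutive
    values.\<close>
  have "(-1) ^ m * secant_sum m = c m \<and> (-1) ^ Suc m * secant_sum (Suc m) = c (Suc m)"
  proof (induction m)
    case 0
    have "qtri 1 = q" "qfact 2 = (1 - q) * q2fact 1"
      using qtri_Suc[of 0] qfact_Suc[of 0] qfact_Suc[of 1] q2fact_Suc[of 0]
      by (simp_all add: numeral_2_eq_2 del: power_Suc)
    then have "secant_term 1 0 = q" "secant_term 1 1 = q * (1 - q)"
      by (simp_all add: secant_term_def numeral_2_eq_2)
    then have "secant_sum 1 = 2 * q - q\<^sup>2"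
      by (simp add: secant_sum_def algebra_simps power2_eq_square)
    then show ?case
      using c_Suc[of 0] by (simp add: c0 power2_eq_square) (simp add: secant_sum_def secant_term_def)
  next
    case (Suc m)
    have rec: "secant_sum (Suc (Suc m)) = q * (1 - q ^ (2 * m + 3)) * secant_sum (Suc m)
        + q ^ (2 * m + 3) * secant_sum m"
      using secant_sum_rec[of m] by (simp add: secant_op_def algebra_simps)
    have "(-1) ^ Suc (Suc m) * secant_sum (Suc (Suc m))
        = - q * (1 - q ^ (2 * m + 3)) * ((-1) ^ Suc m * secant_sum (Suc m))
          + q ^ (2 * m + 3) * ((-1) ^ m * secant_sum m)"
      unfolding rec by (simp add: algebra_simps)
    also have "\<dots> = - q * (1 - q ^ (2 * m + 3)) * c (Suc m) + q ^ (2 * m + 3) * c m"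
      using Suc by simp
    \<comment> \<open>Consecutive inhomogeneous terms of \<open>c_Suc\<close> have ratio -q;
      eliminating them leaves the three-term recurrence.\<close>
    also have "\<dots> = c (Suc (Suc m))"
    proof -
      have "q ^ (2 * m + 3) = q * q ^ (2 * m + 2)" "q ^ (2 * Suc m + 2) = q * q * q ^ (2 * m + 2)"
        by (simp_all add: numeral_3_eq_3)
      then show ?thesis
        unfolding c_Suc[of "Suc m"] c_Suc[of m] by (simp add: algebra_simps)
    qed
    finally show ?case using Suc by blast
  qed
  then show ?thesis by (simp add: c_def)
qed

lemma diagram_gf_closed_form:
  assumes "q \<noteq> 0"
  shows "diagram_gf (2 * N) 0 q = 1 / (1 - q) ^ (2 * N) * (\<Sum>m\<le>N.
    q ^ (m\<^sup>2 + m) * (\<Sum>l = - int m..int m. (-1) powi l * q powi (- (l\<^sup>2))) * ballot N m)"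
proof -
  have "(1 - q) ^ (2 * N) * diagram_gf (2 * N) 0 q = (\<Sum>m\<le>N. ballot N m * cheb (2 * m) 0)"
    using diagram_gf_eq_shift[of "2 * N" 0] by (simp add: shift_iterate)
  also have "\<dots> = (\<Sum>m\<le>N. q ^ (m\<^sup>2 + m)
      * (\<Sum>l = - int m..int m. (-1) powi l * q powi (- (l\<^sup>2))) * ballot N m)"
    unfolding cheb_even_0 secant_sum_eq[OF assms] by (simp only: mult_ac)
  finally show ?thesis
    using one_minus_power_neq_0[of 1] by (simp add: field_simps)
qed

end

theorem corollary1p7:
  fixes N :: nat
  defines "q \<equiv> (fls_X :: rat fls)"
  shows "fps_to_fls (fps_nth G' (2 * N)) =
    1 / (1 - q) ^ (2 * N) *
    (\<Sum>m = 0..N. q ^ (m\<^sup>2 + m) * (\<Sum>l = - int m..int m. (-1) powi l * q powi (- (l\<^sup>2))) *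
       of_nat (2 * m + 1) * of_nat ((2 * N) choose (N + m)) / of_nat (N + m + 1))"
proof -
  \<comment> \<open>Positive powers of the indeterminate have constant coefficient 0, unlike
    1.\<close>
  interpret not_root_of_unity q
  proof
    fix n :: nat
    assume "n > 0"
    then have "fls_nth (q ^ n) 0 = 0" by (simp add: q_def fls_X_power_nth)
    then show "q ^ n \<noteq> 1" by auto
  qed
  have "fps_to_fls (fps_nth G' (2 * N)) = diagram_gf (2 * N) 0 q"
    by (simp add: G'_nth_even fps_to_fls_diagram_gf q_def)
  also have "q \<noteq> 0" by (simp add: q_def)
  note diagram_gf_closed_form[OF this]
  finally show ?thesis
    by (simp only: ballot_eq atMost_atLeast0 times_divide_eq_right mult.assoc)
qed

end
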